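(* Let $\mathscr{H}$ be a complex Hilbert space and let $A,B\in\mathbb{B}(\mathscr{H})$. Then for every real number $r\geq 1$, $$w^{r}(B^{*}A)\leq \frac{1}{4}\big\|(AA^{*})^{r}+(BB^{*})^{r}\big\|+\frac{1}{2}w^{r}(AB^{*}).$$
   Context: $\mathbb{B}(\mathscr{H})$ denotes the $C^*$-algebra of all bounded linear operators on the complex Hilbert space $\mathscr{H}$, and $\|\cdot\|$ is the operator norm. The numerical radius of $A\in\mathbb{B}(\mathscr{H})$ is $w(A)=\sup\{|\langle Ax,x\rangle| : x\in\mathscr{H},\ \|x\|=1\}$, and $w^s(A)$ means $(w(A))^s$. Real powers of positive operators are defined by continuous functional calculus. *)

theory Defs
  imports "HOL-Analysis.Analysis" "HOL-Computational_Algebra.Polynomial"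
begin

text \<open>
  A complex Hilbert space, presented over its underlying real Hilbert space. Positive
  definiteness of \<^term>\<open>cinner\<close> and the law \<open>1 *\<^sub>C x = x\<close> need no axioms of their own:
  they follow from \<open>inner_eq_Re_cinner\<close>, \<open>scaleR_scaleC\<close> and the axioms of
  \<^class>\<open>real_inner\<close>, which also give \<open>norm x = sqrt (Re (cinner x x))\<close>.
  The inner product is linear in its first argument.
\<close>

class complex_hilbert = real_inner + complete_space +
  fixes scaleC :: "complex \<Rightarrow> 'a \<Rightarrow> 'a"  (infixr "*\<^sub>C" 75)
    and cinner :: "'a \<Rightarrow> 'a \<Rightarrow> complex"
  assumes scaleC_add_right: "c *\<^sub>C (x + y) = c *\<^sub>C x + c *\<^sub>C y"
    and scaleC_add_left: "(c + d) *\<^sub>C x = c *\<^sub>C x + d *\<^sub>C x"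
    and scaleC_scaleC: "c *\<^sub>C d *\<^sub>C x = (c * d) *\<^sub>C x"
    and scaleR_scaleC: "a *\<^sub>R x = complex_of_real a *\<^sub>C x"
    and cinner_commute: "cinner x y = cnj (cinner y x)"
    and cinner_add_left: "cinner (x + y) z = cinner x z + cinner y z"
    and cinner_scaleC_left: "cinner (c *\<^sub>C x) y = c * cinner x y"
    and inner_eq_Re_cinner: "inner x y = Re (cinner x y)"

text \<open>
  The bounded operators on \<open>\<H>\<close> are the bounded real-linear maps of type \<open>'a \<Rightarrow>\<^sub>L 'a\<close>
  that are complex linear; the norm of that type is the operator norm.
\<close>

definition complex_linear :: "('a::complex_hilbert \<Rightarrow>\<^sub>L 'a) \<Rightarrow> bool" where
  "complex_linear T \<longleftrightarrow> (\<forall>c x. T (c *\<^sub>C x) = c *\<^sub>C T x)"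

definition adj :: "('a::complex_hilbert \<Rightarrow>\<^sub>L 'a) \<Rightarrow> ('a \<Rightarrow>\<^sub>L 'a)" where
  "adj T = (THE S. complex_linear S \<and> (\<forall>x y. cinner (T x) y = cinner x (S y)))"

text \<open>
  The supremum is taken in \<open>[0, \<infinity>)\<close>: inserting \<open>0\<close> matters only on the zero space, which has
  no unit vectors and where \<^term>\<open>Sup {} :: real\<close> is unspecified.
\<close>

definition numerical_radius :: "('a::complex_hilbert \<Rightarrow>\<^sub>L 'a) \<Rightarrow> real" where
  "numerical_radius T = Sup (insert 0 {cmod (cinner (T x) x) | x. norm x = 1})"

definition op_spectrum :: "('a::complex_hilbert \<Rightarrow>\<^sub>L 'a) \<Rightarrow> complex set" where
  "op_spectrum T = {z. \<not> (\<exists>S. complex_linear S \<and>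
     (\<forall>x. S (T x - z *\<^sub>C x) = x) \<and> (\<forall>x. T (S x) - z *\<^sub>C S x = x))}"

definition op_power :: "('a::complex_hilbert \<Rightarrow>\<^sub>L 'a) \<Rightarrow> nat \<Rightarrow> ('a \<Rightarrow>\<^sub>L 'a)" where
  "op_power T n = ((\<lambda>S. T o\<^sub>L S) ^^ n) id_blinfun"

definition op_poly :: "real poly \<Rightarrow> ('a::complex_hilbert \<Rightarrow>\<^sub>L 'a) \<Rightarrow> ('a \<Rightarrow>\<^sub>L 'a)" where
  "op_poly p T = (\<Sum>i\<le>degree p. coeff p i *\<^sub>R op_power T i)"

text \<open>
  Continuous functional calculus for a self-adjoint operator \<open>T\<close> and a real function \<open>f\<close>
  continuous on the spectrum (which is then a compact set of reals): \<open>f(T)\<close> is the common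
  operator-norm limit of \<open>p\<^sub>n(T)\<close> over all sequences of polynomials \<open>p\<^sub>n\<close> that converge to \<open>f\<close>
  uniformly on the spectrum. Such sequences exist by the Weierstrass theorem, so the limit
  is unique. Nothing is claimed for other \<open>T\<close> or \<open>f\<close>.
\<close>

definition cont_fun_calc ::
    "('a::complex_hilbert \<Rightarrow>\<^sub>L 'a) \<Rightarrow> (real \<Rightarrow> real) \<Rightarrow> ('a \<Rightarrow>\<^sub>L 'a)" where
  "cont_fun_calc T f = (THE S. \<forall>p :: nat \<Rightarrow> real poly.
     uniform_limit {t. complex_of_real t \<in> op_spectrum T} (\<lambda>n. poly (p n)) f sequentially \<longrightarrow>
     (\<lambda>n. op_poly (p n) T) \<longlonglongrightarrow> S)"

text \<open>
  For positive \<open>T\<close> and \<open>r > 0\<close>; since \<open>0 powr r = 0\<close>, the function is then continuous on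
  \<open>[0, \<infinity>)\<close>, which contains the spectrum.
\<close>

definition op_powr :: "('a::complex_hilbert \<Rightarrow>\<^sub>L 'a) \<Rightarrow> real \<Rightarrow> ('a \<Rightarrow>\<^sub>L 'a)" where
  "op_powr T r = cont_fun_calc T (\<lambda>t. t powr r)"

end

theory Submission
  imports Defs "HOL-Computational_Algebra.Fundamental_Theorem_Algebra"
begin

text \<open>
  For a unit vector \<open>x\<close> choose a complex number \<open>c\<close> of modulus one with
  \<open>\<langle>c A x, B x\<rangle> = \<bar>\<langle>B\<^sup>* A x, x\<rangle>\<bar>\<close>. With \<open>C = c A + B\<close>, polarisation gives
  \<open>4 \<langle>c A x, B x\<rangle> \<le> \<parallel>C x\<parallel>\<^sup>2 \<le> \<parallel>C\<parallel>\<^sup>2 = \<parallel>C C\<^sup>*\<parallel>\<close>, and \<open>C C\<^sup>*\<close> is \<open>A A\<^sup>* + B B\<^sup>*\<close> plus twice the real part of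
  \<open>c A B\<^sup>*\<close>. If \<open>2 m\<close> bounds \<open>A A\<^sup>* + B B\<^sup>*\<close>, this yields \<open>w(B\<^sup>* A) \<le> (m + w(A B\<^sup>*)) / 2\<close>
  (lemma \<open>numerical_radius_adj_comp_le\<close>), and convexity of \<open>t\<^sup>r\<close> turns it into
  \<open>w(B\<^sup>* A)\<^sup>r \<le> m\<^sup>r / 2 + w(A B\<^sup>*)\<^sup>r / 2\<close>. That \<open>m\<^sup>r\<close> may be half the norm of
  \<open>(A A\<^sup>*)\<^sup>r + (B B\<^sup>*)\<^sup>r\<close> follows from convexity again and from McCarthy's inequality
  \<open>\<langle>P y, y\<rangle>\<^sup>r \<le> \<langle>P\<^sup>r y, y\<rangle>\<close> for positive \<open>P\<close> and unit \<open>y\<close> (lemma \<open>McCarthy_inequality\<close>).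

  McCarthy's inequality is positivity of the functional calculus applied to \<open>t\<^sup>r\<close> minus one of its
  tangents. The calculus, its existence included, rests on the estimate of \<open>\<parallel>p(T)\<parallel>\<close> by the supremum
  of \<open>\<bar>p\<bar>\<close> over the spectrum, for self-adjoint \<open>T\<close> and real polynomials \<open>p\<close> (lemma
  \<open>norm_op_poly_le\<close>). Its proof combines two facts. A polynomial without roots in the spectrum gives an
  operator that is bounded below, by factoring it into linear terms; and \<open>S\<^sup>2 - \<parallel>S\<parallel>\<^sup>2\<close> is never bounded below
  when \<open>S\<close> is self-adjoint and nonzero. With \<open>S = p(T)\<close>, these force \<open>p\<^sup>2 - \<parallel>p(T)\<parallel>\<^sup>2\<close> to have a root in the
  spectrum.

  Adjoints, and the inclusion of the spectrum of a positive operator \<open>T\<close> in \<open>[0, \<parallel>T\<parallel>]\<close>, both come from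
  minimising a quadratic energy (lemma \<open>symmetric_coercive_solvable\<close>).
\<close>

instance complex_hilbert \<subseteq> banach ..

section \<open>Complex inner products\<close>

lemma scaleC_one [simp]: "1 *\<^sub>C x = (x :: 'a::complex_hilbert)"
  using scaleR_scaleC[of 1 x] by simp

lemma scaleC_zero_left [simp]: "0 *\<^sub>C x = (0 :: 'a::complex_hilbert)"
  using scaleR_scaleC[of 0 x] by simp

lemma scaleC_zero_right [simp]: "c *\<^sub>C (0 :: 'a::complex_hilbert) = 0"
  using scaleC_add_right[of c 0 0] by simp

lemma scaleC_minus_right: "c *\<^sub>C (- x) = - (c *\<^sub>C (x :: 'a::complex_hilbert))"
  using scaleC_add_right[of c x "- x"] by (simp add: add_eq_0_iff)

lemma scaleC_diff_right: "c *\<^sub>C (x - y) = c *\<^sub>C x - c *\<^sub>C (y :: 'a::complex_hilbert)"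
  using scaleC_add_right[of c x "- y"] by (simp add: scaleC_minus_right)

lemma scaleC_minus_left: "(- c) *\<^sub>C x = - (c *\<^sub>C (x :: 'a::complex_hilbert))"
  using scaleC_add_left[of c "- c" x] by (simp add: add_eq_0_iff)

lemma scaleC_scaleR_commute: "c *\<^sub>C (a *\<^sub>R x) = a *\<^sub>R (c *\<^sub>C (x :: 'a::complex_hilbert))"
  by (simp add: scaleR_scaleC scaleC_scaleC mult.commute)

lemma cinner_scaleC_right: "cinner x (c *\<^sub>C y) = cnj c * cinner x (y :: 'a::complex_hilbert)"
  by (metis cinner_commute cinner_scaleC_left complex_cnj_mult)

lemma cinner_eq_inner:
  "cinner x y = Complex (inner x y) (inner x (\<i> *\<^sub>C (y :: 'a::complex_hilbert)))"
  by (rule complex_eqI) (simp_all add: inner_eq_Re_cinner cinner_scaleC_right)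

lemma cinner_self: "cinner x x = complex_of_real ((norm (x :: 'a::complex_hilbert))\<^sup>2)"
proof (rule complex_eqI)
  show "Re (cinner x x) = Re (complex_of_real ((norm x)\<^sup>2))"
    by (simp flip: inner_eq_Re_cinner power2_norm_eq_inner)
  have "Im (cinner x x) = - Im (cinner x x)"
    using arg_cong[OF cinner_commute[of x x], of Im] by simp
  then show "Im (cinner x x) = Im (complex_of_real ((norm x)\<^sup>2))"
    by simp
qed

lemma norm_scaleC [simp]: "norm (c *\<^sub>C x) = cmod c * norm (x :: 'a::complex_hilbert)"
proof -
  have "complex_of_real ((norm (c *\<^sub>C x))\<^sup>2) = complex_of_real ((cmod c * norm x)\<^sup>2)"
    unfolding cinner_self[symmetric] cinner_scaleC_left cinner_scaleC_right
    by (simp add: cinner_self power_mult_distrib complex_norm_square mult_ac del: of_real_power)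
  then have "(norm (c *\<^sub>C x))\<^sup>2 = (cmod c * norm x)\<^sup>2"
    by (simp only: of_real_eq_iff)
  then show ?thesis
    by (simp add: power2_eq_iff_nonneg)
qed

lemma inner_scaleC_left: "inner (c *\<^sub>C x) y = inner x (cnj c *\<^sub>C (y :: 'a::complex_hilbert))"
  by (simp add: inner_eq_Re_cinner cinner_scaleC_left cinner_scaleC_right)

lemma inner_scaleC_self: "inner (c *\<^sub>C x) (d *\<^sub>C x) = Re (c * cnj d) * (norm (x :: 'a::complex_hilbert))\<^sup>2"
  by (simp add: inner_eq_Re_cinner cinner_scaleC_left cinner_scaleC_right cinner_self
      mult.assoc[symmetric] del: of_real_power)

text \<open>Multiplying \<open>x\<close> by the phase conjugate to that of \<open>\<langle>x, y\<rangle>\<close> makes the inner product real, so that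
  statements on moduli of complex inner products reduce to the underlying real space.\<close>

lemma cinner_rotate:
  obtains c where "cmod c = 1" "inner (c *\<^sub>C x) y = cmod (cinner x (y :: 'a::complex_hilbert))"
proof (cases "cinner x y = 0")
  case True
  then show ?thesis
    using that[of 1] by (simp add: inner_eq_Re_cinner)
next
  case False
  define c where "c = cnj (cinner x y) / cmod (cinner x y)"
  have "c * cinner x y = complex_of_real (cmod (cinner x y))"
    using False unfolding c_def
    by (simp add: field_simps complex_norm_square[symmetric] power2_eq_square)
  moreover have "cmod c = 1"
    using False by (simp add: c_def norm_divide)
  ultimately show ?thesis
    using that[of c] by (simp add: inner_eq_Re_cinner cinner_scaleC_left)
qed

lemma cmod_cinner_le: "cmod (cinner x y) \<le> norm x * norm (y :: 'a::complex_hilbert)"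
proof -
  obtain c where c: "cmod c = 1" "inner (c *\<^sub>C x) y = cmod (cinner x y)"
    by (rule cinner_rotate)
  then show ?thesis
    using norm_cauchy_schwarz[of "c *\<^sub>C x" y] by simp
qed

section \<open>Symmetric coercive operators and adjoints\<close>

lemma linear_part_zero_if_quadratic_nonneg:
  fixes d k :: real
  assumes "\<And>s. 0 \<le> 2 * s * d + s\<^sup>2 * k" and k: "k \<ge> 0"
  shows "d = 0"
proof -
  define s where "s = - d / (k + 1)"
  have d: "d = - s * (k + 1)"
    using k by (simp add: s_def)
  have "0 \<le> 2 * s * d + s\<^sup>2 * k"
    by (rule assms)
  also have "\<dots> = - (s\<^sup>2 * (k + 2))"
    by (simp add: d algebra_simps power2_eq_square)
  finally have "s\<^sup>2 * (k + 2) \<le> 0"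
    by simp
  then have "s = 0"
    using k by (simp add: mult_le_0_iff)
  then show ?thesis
    by (simp add: d)
qed

text \<open>The solution minimises the energy \<open>\<langle>R x, x\<rangle> - 2 f x\<close>. By the parallelogram identity for the form of
  \<open>R\<close>, coercivity makes every minimising sequence Cauchy, and the first variation at the limit
  vanishes. For \<open>R\<close> the identity this is the Riesz representation theorem; for a translate of a
  self-adjoint operator it gives invertibility.\<close>

lemma symmetric_coercive_solvable:
  fixes R :: "'a::{real_inner,banach} \<Rightarrow>\<^sub>L 'a" and f :: "'a \<Rightarrow>\<^sub>L real"
  assumes sym: "\<And>x y. inner (R x) y = inner x (R y)"
    and coercive: "\<And>x. c * (norm x)\<^sup>2 \<le> inner (R x) x" and c: "c > 0"
  shows "\<exists>x0. \<forall>v. inner (R x0) v = f v"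
proof -
  define J where "J x = inner (R x) x - 2 * f x" for x
  define m where "m = Inf (range J)"
  have J_ge: "J x \<ge> - ((norm f)\<^sup>2 / c)" for x
  proof -
    have "f x \<le> norm f * norm x"
      using norm_blinfun[of f x] by simp
    then have "J x \<ge> c * (norm x)\<^sup>2 - 2 * (norm f * norm x)"
      using coercive[of x] by (simp add: J_def)
    moreover have "c * (norm x)\<^sup>2 - 2 * (norm f * norm x) + (norm f)\<^sup>2 / c
        = (c * norm x - norm f)\<^sup>2 / c"
      using c by (simp add: field_simps power2_eq_square)
    moreover have "(c * norm x - norm f)\<^sup>2 / c \<ge> 0"
      using c by simp
    ultimately show ?thesis
      by linarith
  qed
  then have bdd: "bdd_below (range J)"
    by (intro bdd_belowI2)
  then have m_le: "m \<le> J x" for x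
    unfolding m_def by (rule cINF_lower) simp
  have "\<exists>x. J x < m + inverse (real (Suc n))" for n
    using cInf_lessD[of "range J" "m + inverse (real (Suc n))"]
    by (auto simp: m_def simp del: of_nat_Suc)
  then obtain X where X: "\<And>n. J (X n) < m + inverse (real (Suc n))"
    by metis
  have par: "J x + J y - 2 * J ((1/2) *\<^sub>R (x + y)) = 1/2 * inner (R (x - y)) (x - y)" for x y
    using sym[of y x]
    by (simp add: J_def blinfun.bilinear_simps inner_simps inner_commute field_simps)
  have close: "c / 2 * (norm (X i - X j))\<^sup>2 \<le> inverse (real (Suc i)) + inverse (real (Suc j))" for i j
    using par[of "X i" "X j"] X[of i] X[of j] m_le[of "(1/2) *\<^sub>R (X i + X j)"]
      coercive[of "X i - X j"] by linarith
  have "Cauchy X"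
  proof (rule metric_CauchyI)
    fix e :: real assume e: "e > 0"
    then obtain N where N: "inverse (real (Suc N)) < c / 4 * e\<^sup>2"
      using reals_Archimedean[of "c / 4 * e\<^sup>2"] c by auto
    show "\<exists>M. \<forall>i\<ge>M. \<forall>j\<ge>M. dist (X i) (X j) < e"
    proof (intro exI allI impI)
      fix i j assume "i \<ge> N" "j \<ge> N"
      then have "inverse (real (Suc i)) \<le> inverse (real (Suc N))"
        "inverse (real (Suc j)) \<le> inverse (real (Suc N))"
        by (auto intro!: le_imp_inverse_le)
      then have "c / 2 * (norm (X i - X j))\<^sup>2 < c / 2 * e\<^sup>2"
        using close[of i j] N by linarith
      then have "(norm (X i - X j))\<^sup>2 < e\<^sup>2"
        using c by simp
      then show "dist (X i) (X j) < e"
        using e by (simp add: dist_norm power2_less_imp_less)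
    qed
  qed
  then obtain x0 where x0: "X \<longlonglongrightarrow> x0"
    by (auto simp: Cauchy_convergent_iff convergent_def)
  have "(\<lambda>n. J (X n)) \<longlonglongrightarrow> J x0"
    unfolding J_def by (intro tendsto_intros x0)
  moreover have "(\<lambda>n. m + inverse (real (Suc n))) \<longlonglongrightarrow> m + 0"
    by (intro tendsto_intros LIMSEQ_inverse_real_of_nat)
  ultimately have "J x0 \<le> m + 0"
    by (rule LIMSEQ_le) (use X less_imp_le in blast)
  then have min: "J x0 \<le> J x" for x
    using m_le[of x] by simp
  show ?thesis
  proof (intro exI allI)
    fix v
    have "inner (R x0) v - f v = 0"
    proof (rule linear_part_zero_if_quadratic_nonneg)
      show "inner (R v) v \<ge> 0"
        using coercive[of v] c by (meson mult_nonneg_nonneg order_trans less_imp_le zero_le_power2)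
      show "0 \<le> 2 * s * (inner (R x0) v - f v) + s\<^sup>2 * inner (R v) v" for s
        using min[of "x0 + s *\<^sub>R v"] sym[of v x0]
        by (simp add: J_def blinfun.bilinear_simps inner_simps inner_commute
            algebra_simps power2_eq_square)
    qed
    then show "inner (R x0) v = f v"
      by simp
  qed
qed

lemma real_adjoint_exists:
  fixes T :: "'a::{real_inner,banach} \<Rightarrow>\<^sub>L 'a"
  obtains S :: "'a \<Rightarrow>\<^sub>L 'a" where "\<And>x y. inner (T x) y = inner x (S y)"
proof -
  have "\<exists>z. \<forall>x. inner (T x) y = inner x z" for y
  proof -
    have "\<exists>z. \<forall>v. inner (id_blinfun z) v = (blinfun_inner_left y o\<^sub>L T) v"
      by (rule symmetric_coercive_solvable[where c = 1])
        (simp_all add: power2_norm_eq_inner)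
    then show ?thesis
      by (simp add: inner_commute) metis
  qed
  then obtain g where g: "\<And>x y. inner (T x) y = inner x (g y)"
    by metis
  have "bounded_linear g"
  proof (rule bounded_linear_intro)
    show "g (y + z) = g y + g z" for y z
      by (rule vector_eq_ldot[THEN iffD1]) (simp add: g[symmetric] inner_simps)
    show "g (a *\<^sub>R y) = a *\<^sub>R g y" for a y
      by (rule vector_eq_ldot[THEN iffD1]) (simp add: g[symmetric] inner_simps)
    show "norm (g y) \<le> norm y * norm T" for y
    proof (cases "g y = 0")
      case False
      have "norm (g y) * norm (g y) = inner (T (g y)) y"
        by (simp add: g power2_norm_eq_inner[symmetric] power2_eq_square)
      also have "\<dots> \<le> norm (T (g y)) * norm y"
        by (rule norm_cauchy_schwarz)
      also have "\<dots> \<le> (norm T * norm (g y)) * norm y"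
        by (intro mult_right_mono norm_blinfun) simp
      finally show ?thesis
        using False by (simp add: mult_ac)
    qed simp
  qed
  then show ?thesis
    using that[of "Blinfun g"] g by (simp add: bounded_linear_Blinfun_apply)
qed

text \<open>The adjoint for the real inner product is also the complex adjoint, since a complex-linear \<open>T\<close>
  commutes with multiplication by \<open>\<i>\<close>.\<close>

lemma adj_exists:
  fixes T :: "'a::complex_hilbert \<Rightarrow>\<^sub>L 'a"
  assumes "complex_linear T"
  shows "complex_linear (adj T) \<and> (\<forall>x y. cinner (T x) y = cinner x (adj T y))"
proof -
  have T: "T (c *\<^sub>C x) = c *\<^sub>C T x" for c x
    using assms by (simp add: complex_linear_def)
  obtain S :: "'a \<Rightarrow>\<^sub>L 'a" where S: "\<And>x y. inner (T x) y = inner x (S y)"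
    using real_adjoint_exists by blast
  have S_scaleC: "S (c *\<^sub>C y) = c *\<^sub>C S y" for c y
  proof (rule vector_eq_ldot[THEN iffD1], rule allI)
    fix x
    have "inner x (S (c *\<^sub>C y)) = inner (T (cnj c *\<^sub>C x)) y"
      by (simp add: S[symmetric] T inner_scaleC_left)
    then show "inner x (S (c *\<^sub>C y)) = inner x (c *\<^sub>C S y)"
      by (simp add: S inner_scaleC_left)
  qed
  have "cinner (T x) y = cinner x (S y)" for x y
    by (simp add: cinner_eq_inner S S_scaleC)
  moreover have "S' = S" if "\<forall>x y. cinner (T x) y = cinner x (S' y)" for S' :: "'a \<Rightarrow>\<^sub>L 'a"
  proof (rule blinfun_eqI, rule vector_eq_ldot[THEN iffD1], rule allI)
    fix x y
    have "inner x (S' y) = inner (T x) y"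
      using that by (simp add: inner_eq_Re_cinner)
    then show "inner x (S' y) = inner x (S y)"
      by (simp add: S)
  qed
  ultimately have "\<exists>!S. complex_linear S \<and> (\<forall>x y. cinner (T x) y = cinner x (S y))"
    by (intro ex1I[of _ S] conjI) (simp_all add: complex_linear_def S_scaleC)
  then show ?thesis
    unfolding adj_def by (rule theI')
qed

lemmas complex_linear_adj = adj_exists[THEN conjunct1]
lemmas cinner_adj = adj_exists[THEN conjunct2, rule_format]

lemma inner_adj: "complex_linear T \<Longrightarrow> inner (T x) y = inner x (adj T y)"
  by (simp add: inner_eq_Re_cinner cinner_adj)

section \<open>Self-adjoint operators and their real spectrum\<close>

text \<open>For complex-linear operators, symmetry for the real inner product agrees with symmetry for the
  complex one.\<close>

definition selfadjoint :: "('a::complex_hilbert \<Rightarrow>\<^sub>L 'a) \<Rightarrow> bool" where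
  "selfadjoint T \<longleftrightarrow> complex_linear T \<and> (\<forall>x y. inner (T x) y = inner x (T y))"

lemma selfadjointD:
  assumes "selfadjoint T"
  shows "T (c *\<^sub>C x) = c *\<^sub>C T x" "inner (T x) y = inner x (T y)"
  using assms by (auto simp: selfadjoint_def complex_linear_def)

definition real_spectrum :: "('a::complex_hilbert \<Rightarrow>\<^sub>L 'a) \<Rightarrow> real set" where
  "real_spectrum T = {t. complex_of_real t \<in> op_spectrum T}"

definition bounded_below :: "('a::real_normed_vector \<Rightarrow> 'b::real_normed_vector) \<Rightarrow> bool" where
  "bounded_below f \<longleftrightarrow> (\<exists>c>0. \<forall>x. c * norm x \<le> norm (f x))"

lemma bounded_below_compose:
  assumes "bounded_below f" "bounded_below g"
  shows "bounded_below (\<lambda>x. f (g x))"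
proof -
  obtain c d where c: "c > 0" "\<And>x. c * norm x \<le> norm (f x)"
    and d: "d > 0" "\<And>x. d * norm x \<le> norm (g x)"
    using assms by (auto simp: bounded_below_def)
  have "(c * d) * norm x \<le> norm (f (g x))" for x
  proof -
    have "c * (d * norm x) \<le> c * norm (g x)"
      using c(1) d(2) by simp
    also have "\<dots> \<le> norm (f (g x))"
      by (rule c(2))
    finally show ?thesis
      by simp
  qed
  then show ?thesis
    using c(1) d(1) unfolding bounded_below_def by (meson mult_pos_pos)
qed

text \<open>For non-real \<open>z\<close> the imaginary part of \<open>\<langle>(T - z) x, x\<rangle>\<close> is \<open>- Im z \<parallel>x\<parallel>\<^sup>2\<close>, and outside the
  spectrum a bounded inverse gives the lower bound. So only the real points of
  the spectrum can obstruct a lower bound.\<close>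

lemma bounded_below_shift:
  assumes T: "selfadjoint T" and z: "\<And>t. z = complex_of_real t \<Longrightarrow> t \<notin> real_spectrum T"
  shows "bounded_below (\<lambda>x. T x - z *\<^sub>C x)"
proof (cases "Im z = 0")
  case False
  have "\<bar>Im z\<bar> * norm x \<le> norm (T x - z *\<^sub>C x)" for x
  proof (cases "x = 0")
    case x: False
    have "inner (T x) (\<i> *\<^sub>C x) = - inner (\<i> *\<^sub>C x) (T x)"
      using T by (simp add: selfadjointD inner_scaleC_left scaleC_minus_left)
    then have "inner (T x) (\<i> *\<^sub>C x) = 0"
      by (simp add: inner_commute)
    then have "inner (T x - z *\<^sub>C x) (\<i> *\<^sub>C x) = - Im z * (norm x)\<^sup>2"
      by (simp add: inner_diff_left inner_scaleC_self)
    then have "\<bar>Im z\<bar> * (norm x)\<^sup>2 \<le> norm (T x - z *\<^sub>C x) * norm x"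
      using Cauchy_Schwarz_ineq2[of "T x - z *\<^sub>C x" "\<i> *\<^sub>C x"] by (simp add: abs_mult)
    then show ?thesis
      using x by (simp add: power2_eq_square)
  qed simp
  then show ?thesis
    using False unfolding bounded_below_def by (intro exI[of _ "\<bar>Im z\<bar>"]) auto
next
  case True
  then have "z = complex_of_real (Re z)"
    by (simp add: complex_eq_iff)
  then have "z \<notin> op_spectrum T"
    using z[of "Re z"] by (simp add: real_spectrum_def)
  then obtain S :: "'a \<Rightarrow>\<^sub>L 'a" where S: "\<And>x. S (T x - z *\<^sub>C x) = x"
    by (auto simp: op_spectrum_def)
  have "inverse (norm S + 1) * norm x \<le> norm (T x - z *\<^sub>C x)" for x
  proof -
    have "norm x \<le> norm S * norm (T x - z *\<^sub>C x)"
      using norm_blinfun[of S "T x - z *\<^sub>C x"] by (simp add: S)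
    also have "\<dots> \<le> (norm S + 1) * norm (T x - z *\<^sub>C x)"
      by (intro mult_right_mono) auto
    finally show ?thesis
      by (simp add: mult.commute[of "inverse _"] pos_divide_le_eq add_nonneg_pos mult.commute
          flip: divide_inverse)
  qed
  then show ?thesis
    unfolding bounded_below_def
    by (intro exI[of _ "inverse (norm S + 1)"]) (auto simp: add_nonneg_pos)
qed

lemma coercive_invertible:
  fixes R :: "'a::complex_hilbert \<Rightarrow>\<^sub>L 'a"
  assumes R: "selfadjoint R" and coercive: "\<And>x. c * (norm x)\<^sup>2 \<le> inner (R x) x" and c: "c > 0"
  obtains S :: "'a \<Rightarrow>\<^sub>L 'a" where "complex_linear S" "\<And>x. S (R x) = x" "\<And>x. R (S x) = x"
proof -
  have lower: "c * norm x \<le> norm (R x)" for x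
  proof (cases "x = 0")
    case False
    have "c * (norm x)\<^sup>2 \<le> norm (R x) * norm x"
      using coercive[of x] norm_cauchy_schwarz[of "R x" x] by linarith
    then show ?thesis
      using False by (simp add: power2_eq_square mult.assoc[symmetric])
  qed simp
  have inj: "x = y" if "R x = R y" for x y
    using lower[of "x - y"] that c by (simp add: blinfun.diff_right mult_le_0_iff)
  have "\<exists>x. R x = y" for y
  proof -
    obtain x where "\<forall>v. inner (R x) v = blinfun_inner_left y v"
      using symmetric_coercive_solvable[OF selfadjointD(2)[OF R] coercive c] by blast
    then have "\<forall>v. inner (R x) v = inner y v"
      by (simp add: inner_commute)
    then have "R x = y"
      by (rule vector_eq_rdot[THEN iffD1])
    then show ?thesis
      by blast
  qed
  then obtain g where g: "\<And>y. R (g y) = y"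
    by metis
  have "bounded_linear g"
  proof (rule bounded_linear_intro)
    show "g (y + z) = g y + g z" for y z
      by (rule inj) (simp add: g blinfun.add_right)
    show "g (a *\<^sub>R y) = a *\<^sub>R g y" for a y
      by (rule inj) (simp add: g blinfun.scaleR_right)
    show "norm (g y) \<le> norm y * inverse c" for y
      using lower[of "g y"] c by (simp add: g field_simps)
  qed
  then have apply_g: "blinfun_apply (Blinfun g) = g"
    by (rule bounded_linear_Blinfun_apply)
  show ?thesis
  proof
    show "complex_linear (Blinfun g)"
      unfolding complex_linear_def apply_g
      by (intro allI, rule inj) (simp add: g selfadjointD(1)[OF R])
    show "Blinfun g (R x) = x" for x
      by (rule inj) (simp add: apply_g g)
    show "R (Blinfun g x) = x" for x
      by (simp add: apply_g g)
  qed
qed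

text \<open>Outside \<open>[0, \<parallel>T\<parallel>]\<close> one of \<open>T - t\<close> and \<open>t - T\<close> is coercive.\<close>

lemma real_spectrum_positive:
  fixes T :: "'a::complex_hilbert \<Rightarrow>\<^sub>L 'a"
  assumes T: "selfadjoint T" and pos: "\<And>x. 0 \<le> inner (T x) x"
  shows "real_spectrum T \<subseteq> {0..norm T}"
proof
  fix t assume t: "t \<in> real_spectrum T"
  define R where "R = T - t *\<^sub>R id_blinfun"
  have R: "R x = T x - complex_of_real t *\<^sub>C x" for x
    by (simp add: R_def blinfun.bilinear_simps scaleR_scaleC)
  have sa: "selfadjoint R" "selfadjoint (- R)"
    using T by (auto simp: selfadjoint_def complex_linear_def R scaleC_diff_right scaleC_scaleC
        mult.commute inner_diff_left inner_diff_right inner_scaleC_left blinfun.minus_left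
        scaleC_minus_right)
  have R_inner: "inner (R x) x = inner (T x) x - t * (norm x)\<^sup>2" for x
    by (simp add: R_def blinfun.bilinear_simps inner_diff_left power2_norm_eq_inner)
  have not_inverse: False if "complex_linear S" "\<And>x. S (R x) = x" "\<And>x. R (S x) = x"
    for S :: "'a \<Rightarrow>\<^sub>L 'a"
  proof -
    have "complex_of_real t \<notin> op_spectrum T"
      unfolding op_spectrum_def using that by (auto simp: R)
    with t show False
      by (simp add: real_spectrum_def)
  qed
  have "\<not> t < 0"
  proof
    assume "t < 0"
    then show False
      using coercive_invertible[OF sa(1), of "- t"] pos not_inverse by (auto simp: R_inner)
  qed
  moreover have "\<not> t > norm T"
  proof
    assume t: "t > norm T"
    have coercive: "(t - norm T) * (norm x)\<^sup>2 \<le> inner ((- R) x) x" for x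
    proof -
      have "inner (T x) x \<le> norm (T x) * norm x"
        by (rule norm_cauchy_schwarz)
      also have "\<dots> \<le> (norm T * norm x) * norm x"
        by (intro mult_right_mono norm_blinfun) simp
      finally show ?thesis
        by (simp add: blinfun.minus_left R_inner algebra_simps power2_eq_square)
    qed
    obtain S :: "'a \<Rightarrow>\<^sub>L 'a" where S: "complex_linear S" "\<And>x. S ((- R) x) = x" "\<And>x. (- R) (S x) = x"
      using coercive_invertible[OF sa(2) coercive] t by auto
    show False
      by (rule not_inverse[of "- S"])
        (use S in \<open>auto simp: complex_linear_def blinfun.minus_left blinfun.minus_right scaleC_minus_right\<close>)
  qed
  ultimately show "t \<in> {0..norm T}"
    by auto
qed

section \<open>Polynomials of a self-adjoint operator\<close>

lemma op_poly_0 [simp]: "op_poly 0 T = 0"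
  by (simp add: op_poly_def)

lemma op_poly_pCons: "op_poly (pCons a p) T = a *\<^sub>R id_blinfun + (T o\<^sub>L op_poly p T)"
proof (cases "p = 0")
  case True
  then show ?thesis
    by (simp add: op_poly_def op_power_def)
next
  case False
  have "op_poly (pCons a p) T
      = a *\<^sub>R op_power T 0 + (\<Sum>i\<le>degree p. coeff p i *\<^sub>R op_power T (Suc i))"
    unfolding op_poly_def using False by (simp add: sum.atMost_Suc_shift del: sum.atMost_Suc)
  also have "(\<Sum>i\<le>degree p. coeff p i *\<^sub>R op_power T (Suc i)) = T o\<^sub>L op_poly p T"
    by (rule blinfun_eqI) (simp add: op_poly_def op_power_def blinfun.sum_left blinfun.sum_right
        blinfun.scaleR_left blinfun.scaleR_right)
  finally show ?thesis
    by (simp add: op_power_def)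
qed

lemma op_poly_apply_pCons: "op_poly (pCons a p) T x = a *\<^sub>R x + T (op_poly p T x)"
  by (simp add: op_poly_pCons blinfun.add_left blinfun.scaleR_left)

lemma op_poly_add: "op_poly (p + q) T = op_poly p T + op_poly q T"
  by (induction p q rule: poly_induct2)
    (auto intro!: blinfun_eqI simp: op_poly_apply_pCons blinfun.bilinear_simps algebra_simps)

lemma op_poly_smult: "op_poly (smult c p) T = c *\<^sub>R op_poly p T"
  by (induction p)
    (auto intro!: blinfun_eqI simp: op_poly_apply_pCons blinfun.bilinear_simps algebra_simps)

lemma op_poly_diff: "op_poly (p - q) T = op_poly p T - op_poly q T"
  using op_poly_add[of "p - q" q T] by simp

lemma op_poly_mult: "op_poly (p * q) T = op_poly p T o\<^sub>L op_poly q T"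
  by (induction p)
    (auto intro!: blinfun_eqI simp: op_poly_apply_pCons op_poly_add op_poly_smult blinfun.bilinear_simps)

lemma selfadjoint_op_poly:
  assumes T: "selfadjoint T"
  shows "selfadjoint (op_poly p T)"
proof (induction p)
  case 0
  then show ?case
    by (simp add: selfadjoint_def complex_linear_def)
next
  case (pCons a p)
  have comm: "op_poly p T (T x) = T (op_poly p T x)" for x
  proof -
    have "op_poly (p * [:0, 1:]) T x = op_poly ([:0, 1:] * p) T x"
      by (simp only: mult.commute)
    then show ?thesis
      unfolding op_poly_mult by (simp add: op_poly_apply_pCons)
  qed
  show ?case
    using T pCons.IH
    by (auto simp: selfadjoint_def complex_linear_def op_poly_apply_pCons scaleC_add_right
        scaleC_scaleR_commute inner_add_left inner_add_right comm)
qed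

text \<open>Evaluation by Horner's rule. Complex coefficients are required because a real polynomial splits
  into linear factors only over the complex numbers.\<close>

definition cpoly_apply :: "complex poly \<Rightarrow> ('a::complex_hilbert \<Rightarrow>\<^sub>L 'a) \<Rightarrow> 'a \<Rightarrow> 'a" where
  "cpoly_apply P T x = fold_coeffs (\<lambda>a y. a *\<^sub>C x + T y) P 0"

lemma cpoly_apply_0 [simp]: "cpoly_apply 0 T x = 0"
  by (simp add: cpoly_apply_def)

lemma cpoly_apply_pCons: "cpoly_apply (pCons a P) T x = a *\<^sub>C x + T (cpoly_apply P T x)"
  by (cases "P = 0 \<and> a = 0") (auto simp: cpoly_apply_def)

lemma cpoly_apply_add: "cpoly_apply (P + Q) T x = cpoly_apply P T x + cpoly_apply Q T x"
  by (induction P Q rule: poly_induct2)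
    (auto simp: cpoly_apply_pCons blinfun.add_right scaleC_add_left)

lemma cpoly_apply_smult:
  assumes "selfadjoint T"
  shows "cpoly_apply (smult c P) T x = c *\<^sub>C cpoly_apply P T x"
  by (induction P)
    (auto simp: cpoly_apply_pCons selfadjointD(1)[OF assms] scaleC_add_right scaleC_scaleC)

lemma cpoly_apply_of_real: "cpoly_apply (map_poly of_real p) T x = op_poly p T x"
  by (induction p) (auto simp: cpoly_apply_pCons op_poly_apply_pCons map_poly_pCons scaleR_scaleC)

lemma poly_map_poly_of_real: "poly (map_poly of_real p) (complex_of_real t) = of_real (poly p t)"
  by (induction p) (auto simp: map_poly_pCons)

text \<open>By the fundamental theorem of algebra, \<open>P(T)\<close> is a composition of factors \<open>T - z\<close> over the roots \<open>z\<close> of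
  \<open>P\<close>, each bounded below. This half of the spectral mapping theorem is enough for the norm bound.\<close>

lemma bounded_below_cpoly_apply:
  assumes T: "selfadjoint T" and "P \<noteq> 0"
    and "\<And>t. t \<in> real_spectrum T \<Longrightarrow> poly P (complex_of_real t) \<noteq> 0"
  shows "bounded_below (cpoly_apply P T)"
  using assms(2,3)
proof (induction "degree P" arbitrary: P)
  case 0
  then obtain a where "P = [:a:]" "a \<noteq> 0"
    by (metis degree_eq_zeroE pCons_0_0)
  then show ?case
    unfolding bounded_below_def
    by (intro exI[of _ "cmod a"]) (auto simp: cpoly_apply_pCons)
next
  case (Suc n)
  then obtain z where z: "poly P z = 0"
    using fundamental_theorem_of_algebra[of P] by (auto simp: constant_degree)
  define Q where "Q = synthetic_div P z"
  have PQ: "P = [:- z, 1:] * Q"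
    using synthetic_div_correct'[of z P] z by (simp add: Q_def)
  then have PQ': "P = pCons 0 Q + smult (- z) Q"
    by simp
  have Q: "Q \<noteq> 0"
    using Suc.prems(1) PQ by auto
  have "n = degree Q"
    using Suc.hyps(2) by (simp add: Q_def degree_synthetic_div)
  moreover have "poly Q (complex_of_real t) \<noteq> 0" if "t \<in> real_spectrum T" for t
    using Suc.prems(2)[OF that] by (auto simp: PQ)
  ultimately have "bounded_below (cpoly_apply Q T)"
    using Suc.hyps(1) Q by blast
  moreover have "bounded_below (\<lambda>x. T x - z *\<^sub>C x)"
    using T
  proof (rule bounded_below_shift)
    show "t \<notin> real_spectrum T" if "z = complex_of_real t" for t
      using Suc.prems(2)[of t] z that by auto
  qed
  moreover have "cpoly_apply P T = (\<lambda>x. T (cpoly_apply Q T x) - z *\<^sub>C cpoly_apply Q T x)"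
    by (rule ext) (simp add: PQ' cpoly_apply_add cpoly_apply_smult[OF T] cpoly_apply_pCons scaleC_minus_left
        del: smult_minus_left)
  ultimately show ?case
    using bounded_below_compose[of "\<lambda>x. T x - z *\<^sub>C x" "cpoly_apply Q T"] by simp
qed

text \<open>If \<open>\<parallel>S x\<^sub>n\<parallel>\<close> tends to \<open>\<parallel>S\<parallel>\<close> for unit vectors \<open>x\<^sub>n\<close>, then \<open>S\<^sup>2 x\<^sub>n - \<parallel>S\<parallel>\<^sup>2 x\<^sub>n\<close> tends to \<open>0\<close>, by expanding
  the square of its norm. The proof uses that estimate in contrapositive form.\<close>

lemma not_bounded_below_square_minus_norm:
  assumes S: "selfadjoint S" and "S \<noteq> 0"
  shows "\<not> bounded_below (\<lambda>x. S (S x) - (norm S)\<^sup>2 *\<^sub>R x)"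
proof
  define M where "M = norm S"
  assume "bounded_below (\<lambda>x. S (S x) - (norm S)\<^sup>2 *\<^sub>R x)"
  then obtain c where c: "c > 0" "\<And>x. c * norm x \<le> norm (S (S x) - M\<^sup>2 *\<^sub>R x)"
    by (auto simp: bounded_below_def M_def)
  have M: "M > 0"
    using assms(2) by (simp add: M_def)
  have bound: "(norm (S x))\<^sup>2 \<le> (M\<^sup>2 - c\<^sup>2 / M\<^sup>2) * (norm x)\<^sup>2" for x
  proof -
    have "(norm (S (S x)))\<^sup>2 \<le> (M * norm (S x))\<^sup>2"
      unfolding M_def by (intro power_mono norm_blinfun) simp
    moreover have "(c * norm x)\<^sup>2 \<le> (norm (S (S x) - M\<^sup>2 *\<^sub>R x))\<^sup>2"
      using c by (intro power_mono) auto
    moreover have "(norm (S (S x) - M\<^sup>2 *\<^sub>R x))\<^sup>2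
        = (norm (S (S x)))\<^sup>2 - 2 * M\<^sup>2 * (norm (S x))\<^sup>2 + M\<^sup>2 * M\<^sup>2 * (norm x)\<^sup>2"
      using selfadjointD(2)[OF S, of "S x" x]
      by (simp add: power2_norm_eq_inner inner_diff_left inner_diff_right inner_commute)
    ultimately have "M\<^sup>2 * (norm (S x))\<^sup>2 \<le> (M\<^sup>2 * M\<^sup>2 - c\<^sup>2) * (norm x)\<^sup>2"
      by (simp add: power_mult_distrib algebra_simps)
    then show ?thesis
      using M by (simp add: field_simps)
  qed
  obtain x where "S x \<noteq> 0"
    using assms(2) by (metis blinfun_eqI zero_blinfun.rep_eq)
  then have "0 < (M\<^sup>2 - c\<^sup>2 / M\<^sup>2) * (norm x)\<^sup>2"
    using bound[of x] by (meson less_le_trans zero_less_norm_iff zero_less_power)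
  then have K: "M\<^sup>2 - c\<^sup>2 / M\<^sup>2 > 0"
    by (simp add: zero_less_mult_iff)
  have "M \<le> sqrt (M\<^sup>2 - c\<^sup>2 / M\<^sup>2)"
    unfolding M_def
  proof (rule norm_blinfun_bound)
    fix x
    show "norm (S x) \<le> sqrt ((norm S)\<^sup>2 - c\<^sup>2 / (norm S)\<^sup>2) * norm x"
      using bound[of x] K
      by (intro power2_le_imp_le[of "norm (S x)"]) (simp_all add: power_mult_distrib M_def)
  qed (use K in \<open>simp add: M_def\<close>)
  then have "M\<^sup>2 \<le> (sqrt (M\<^sup>2 - c\<^sup>2 / M\<^sup>2))\<^sup>2"
    using M by (intro power_mono) auto
  also have "\<dots> = M\<^sup>2 - c\<^sup>2 / M\<^sup>2"
    using K by simp
  finally have "M\<^sup>2 \<le> M\<^sup>2 - c\<^sup>2 / M\<^sup>2" .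
  then show False
    using c(1) M by (simp add: divide_le_0_iff)
qed

text \<open>If the polynomial \<open>p\<^sup>2 - \<parallel>p(T)\<parallel>\<^sup>2\<close> had no root in the spectrum, its value at \<open>T\<close> would be bounded
  below, against \<open>not_bounded_below_square_minus_norm\<close>.\<close>

lemma spectral_value_of_norm_nonconst:
  assumes T: "selfadjoint T" and "op_poly p T \<noteq> 0" and nz: "p * p \<noteq> [:(norm (op_poly p T))\<^sup>2:]"
  shows "\<exists>t\<in>real_spectrum T. \<bar>poly p t\<bar> = norm (op_poly p T)"
proof (rule ccontr)
  define M where "M = norm (op_poly p T)"
  define q where "q = p * p - [:M\<^sup>2:]"
  assume neg: "\<not> ?thesis"
  have "bounded_below (cpoly_apply (map_poly of_real q) T)"
  proof (rule bounded_below_cpoly_apply[OF T])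
    show "map_poly complex_of_real q \<noteq> 0"
      using nz by (simp add: q_def M_def map_poly_eq_0_iff)
    show "poly (map_poly complex_of_real q) (complex_of_real t) \<noteq> 0" if "t \<in> real_spectrum T" for t
    proof -
      have "\<bar>poly p t\<bar> \<noteq> M"
        using neg that by (auto simp: M_def)
      then have "(poly p t)\<^sup>2 \<noteq> M\<^sup>2"
        by (metis M_def abs_norm_cancel power2_eq_iff abs_minus_cancel)
      then show ?thesis
        unfolding poly_map_poly_of_real of_real_eq_0_iff by (simp add: q_def power2_eq_square)
    qed
  qed
  moreover have "cpoly_apply (map_poly of_real q) T x
      = op_poly p T (op_poly p T x) - M\<^sup>2 *\<^sub>R x" for x
    by (simp add: cpoly_apply_of_real q_def op_poly_diff op_poly_mult op_poly_pCons
        blinfun.bilinear_simps)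
  ultimately have "bounded_below (\<lambda>x. op_poly p T (op_poly p T x) - M\<^sup>2 *\<^sub>R x)"
    by (simp add: bounded_below_def)
  then show False
    using not_bounded_below_square_minus_norm[OF selfadjoint_op_poly[OF T] assms(2)]
    by (simp add: M_def)
qed

text \<open>All properties of the functional calculus come from this estimate: it makes \<open>p \<mapsto> p(T)\<close> continuous
  from the sup norm on the spectrum to the operator norm.\<close>

lemma norm_op_poly_le:
  assumes T: "selfadjoint T" and e: "e \<ge> 0" and le: "\<And>t. t \<in> real_spectrum T \<Longrightarrow> \<bar>poly p t\<bar> \<le> e"
  shows "norm (op_poly p T) \<le> e"
proof (cases "op_poly p T = 0")
  case nonzero: False
  show ?thesis
  proof (cases "p * p = [:(norm (op_poly p T))\<^sup>2:]")
    case False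
    then show ?thesis
      using spectral_value_of_norm_nonconst[OF T nonzero] le by metis
  next
    case True
    \<comment> \<open>Here \<open>\<bar>p\<bar>\<close> is constant, and it suffices that the spectrum is not empty.\<close>
    have "\<exists>t. t \<in> real_spectrum T"
    proof (cases "T = 0")
      case True
      obtain x where "op_poly p T x \<noteq> 0"
        using nonzero by (metis blinfun_eqI zero_blinfun.rep_eq)
      then have "x \<noteq> 0"
        by auto
      then have "0 \<in> real_spectrum T"
        by (auto simp: real_spectrum_def op_spectrum_def True)
      then show ?thesis
        by blast
    next
      case False
      have X: "op_poly [:0, 1:] T = T"
        by (rule blinfun_eqI) (simp add: op_poly_apply_pCons)
      have "\<exists>t\<in>real_spectrum T. \<bar>poly [:0, 1:] t\<bar> = norm (op_poly [:0, 1:] T)"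
        by (rule spectral_value_of_norm_nonconst[OF T]) (use False in \<open>simp_all add: X\<close>)
      then show ?thesis
        by blast
    qed
    then obtain t where t: "t \<in> real_spectrum T"
      by blast
    have "(poly p t)\<^sup>2 = (norm (op_poly p T))\<^sup>2"
      using arg_cong[OF True, of "\<lambda>q. poly q t"] by (simp add: power2_eq_square)
    then have "\<bar>poly p t\<bar> = norm (op_poly p T)"
      by (metis abs_norm_cancel power2_eq_iff abs_minus_cancel)
    then show ?thesis
      using le[OF t] by simp
  qed
qed (use e in simp)

section \<open>The continuous functional calculus\<close>

lemma polynomials_converge_uniformly:
  fixes f :: "real \<Rightarrow> real"
  assumes "continuous_on {a..b} f"
  obtains p where "uniform_limit {a..b} (\<lambda>n. poly (p n)) f sequentially"
proof -
  have "\<exists>q. \<forall>x\<in>{a..b}. dist (poly q x) (f x) < inverse (real (Suc n))" for n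
  proof -
    obtain g where g: "real_polynomial_function g"
      "\<And>x. x \<in> {a..b} \<Longrightarrow> \<bar>f x - g x\<bar> < inverse (real (Suc n))"
      using Stone_Weierstrass_real_polynomial_function[OF compact_Icc assms, of "inverse (real (Suc n))"]
      by auto
    then obtain c k where "g = (\<lambda>x. \<Sum>i\<le>k. c i * x ^ i)"
      by (auto simp: real_polynomial_function_iff_sum)
    then have "g = poly (\<Sum>i\<le>k. monom (c i) i)"
      by (auto simp: poly_sum poly_monom)
    then have "\<forall>x\<in>{a..b}. dist (poly (\<Sum>i\<le>k. monom (c i) i) x) (f x) < inverse (real (Suc n))"
      using g(2) by (simp add: dist_real_def abs_minus_commute)
    then show ?thesis
      by blast
  qed
  then obtain p where p: "\<And>n x. x \<in> {a..b} \<Longrightarrow> dist (poly (p n) x) (f x) < inverse (real (Suc n))"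
    by metis
  have "uniform_limit {a..b} (\<lambda>n. poly (p n)) f sequentially"
    unfolding uniform_limit_sequentially_iff
  proof (intro allI impI)
    fix e :: real assume "e > 0"
    then obtain N where N: "inverse (real (Suc N)) < e"
      using reals_Archimedean by blast
    show "\<exists>N. \<forall>n\<ge>N. \<forall>x\<in>{a..b}. dist (poly (p n) x) (f x) < e"
    proof (intro exI allI impI ballI)
      fix n x assume n: "n \<ge> N" and x: "x \<in> {a..b}"
      have "inverse (real (Suc n)) \<le> inverse (real (Suc N))"
        using n by (intro le_imp_inverse_le) auto
      then show "dist (poly (p n) x) (f x) < e"
        using p[OF x, of n] N by linarith
    qed
  qed
  then show ?thesis
    by (rule that)
qed

lemma op_poly_close_if_same_limit:
  assumes T: "selfadjoint T"
    and p: "uniform_limit (real_spectrum T) (\<lambda>n. poly (p n)) f sequentially"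
    and q: "uniform_limit (real_spectrum T) (\<lambda>n. poly (q n)) f sequentially"
    and e: "e > 0"
  shows "\<exists>N. \<forall>m\<ge>N. \<forall>n\<ge>N. dist (op_poly (p m) T) (op_poly (q n) T) < e"
proof -
  obtain N1 where N1: "\<And>n x. n \<ge> N1 \<Longrightarrow> x \<in> real_spectrum T \<Longrightarrow> \<bar>poly (p n) x - f x\<bar> < e / 4"
    using p e unfolding uniform_limit_sequentially_iff dist_real_def
    by (metis zero_less_divide_iff zero_less_numeral)
  obtain N2 where N2: "\<And>n x. n \<ge> N2 \<Longrightarrow> x \<in> real_spectrum T \<Longrightarrow> \<bar>poly (q n) x - f x\<bar> < e / 4"
    using q e unfolding uniform_limit_sequentially_iff dist_real_def
    by (metis zero_less_divide_iff zero_less_numeral)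
  show ?thesis
  proof (intro exI allI impI)
    fix m n assume mn: "m \<ge> max N1 N2" "n \<ge> max N1 N2"
    have "norm (op_poly (p m - q n) T) \<le> e / 2"
    proof (rule norm_op_poly_le[OF T])
      fix t assume "t \<in> real_spectrum T"
      then show "\<bar>poly (p m - q n) t\<bar> \<le> e / 2"
        using N1[of m t] N2[of n t] mn by (simp add: abs_if split: if_splits)
    qed (use e in simp)
    then show "dist (op_poly (p m) T) (op_poly (q n) T) < e"
      using e by (simp add: dist_norm op_poly_diff)
  qed
qed

text \<open>This shows that the calculus is well defined: the norm bound makes \<open>p\<^sub>n(T)\<close> Cauchy, and two sequences with the same
  limit on the spectrum can be compared with each other.\<close>

lemma cont_fun_calc_limit:
  assumes T: "selfadjoint T" and spec: "real_spectrum T \<subseteq> {a..b}" and f: "continuous_on {a..b} f"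
    and p: "uniform_limit (real_spectrum T) (\<lambda>n. poly (p n)) f sequentially"
  shows "(\<lambda>n. op_poly (p n) T) \<longlonglongrightarrow> cont_fun_calc T f"
proof -
  obtain q where "uniform_limit {a..b} (\<lambda>n. poly (q n)) f sequentially"
    using polynomials_converge_uniformly[OF f] .
  then have q: "uniform_limit (real_spectrum T) (\<lambda>n. poly (q n)) f sequentially"
    using spec by (rule uniform_limit_on_subset)
  have "Cauchy (\<lambda>n. op_poly (q n) T)"
    using op_poly_close_if_same_limit[OF T q q] by (auto intro!: metric_CauchyI)
  then obtain S where S: "(\<lambda>n. op_poly (q n) T) \<longlonglongrightarrow> S"
    by (auto simp: Cauchy_convergent_iff convergent_def)
  have all: "(\<lambda>n. op_poly (p' n) T) \<longlonglongrightarrow> S"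
    if p': "uniform_limit (real_spectrum T) (\<lambda>n. poly (p' n)) f sequentially" for p'
  proof (rule Lim_transform[OF S])
    show "(\<lambda>n. op_poly (p' n) T - op_poly (q n) T) \<longlonglongrightarrow> 0"
    proof (rule LIMSEQ_I)
      fix e :: real assume "e > 0"
      then show "\<exists>N. \<forall>n\<ge>N. norm (op_poly (p' n) T - op_poly (q n) T - 0) < e"
        using op_poly_close_if_same_limit[OF T p' q] by (fastforce simp: dist_norm)
    qed
  qed
  have "cont_fun_calc T f = S"
    unfolding cont_fun_calc_def
  proof (rule the_equality)
    show "\<forall>p. uniform_limit {t. complex_of_real t \<in> op_spectrum T} (\<lambda>n. poly (p n)) f sequentially \<longrightarrow>
        (\<lambda>n. op_poly (p n) T) \<longlonglongrightarrow> S"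
      using all by (simp add: real_spectrum_def)
    fix S' assume "\<forall>p. uniform_limit {t. complex_of_real t \<in> op_spectrum T} (\<lambda>n. poly (p n)) f sequentially \<longrightarrow>
        (\<lambda>n. op_poly (p n) T) \<longlonglongrightarrow> S'"
    then have "(\<lambda>n. op_poly (q n) T) \<longlonglongrightarrow> S'"
      using q by (simp add: real_spectrum_def)
    then show "S' = S"
      using S by (rule LIMSEQ_unique)
  qed
  then show ?thesis
    using all[OF p] by simp
qed

text \<open>Because \<open>q\<close> lies between \<open>- e\<close> and some \<open>K\<close> on the spectrum, \<open>q(T)\<close> differs from the midpoint
  \<open>(K - e) / 2\<close> by an operator of norm at most \<open>(K + e) / 2\<close>. So positivity of the calculus follows from
  the norm bound alone.\<close>

lemma inner_op_poly_ge:
  assumes T: "selfadjoint T" and spec: "real_spectrum T \<subseteq> {a..b}"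
    and ge: "\<And>t. t \<in> real_spectrum T \<Longrightarrow> - e \<le> poly q t"
  shows "- e * (norm x)\<^sup>2 \<le> inner (op_poly q T x) x"
proof -
  have "bounded (poly q ` {a..b})"
    by (intro compact_imp_bounded compact_continuous_image continuous_intros) auto
  then obtain K0 where K0: "\<forall>t\<in>{a..b}. \<bar>poly q t\<bar> \<le> K0"
    by (auto simp: bounded_iff)
  define K where "K = max K0 (- e)"
  define d where "d = (K - e) / 2"
  have "norm (op_poly (q - [:d:]) T) \<le> (K + e) / 2"
  proof (rule norm_op_poly_le[OF T])
    show "0 \<le> (K + e) / 2"
      by (simp add: K_def)
    fix t assume t: "t \<in> real_spectrum T"
    then have "poly q t \<le> K"
      using K0 spec by (force simp: K_def)
    then show "\<bar>poly (q - [:d:]) t\<bar> \<le> (K + e) / 2"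
      using ge[OF t] by (simp add: d_def abs_le_iff field_simps)
  qed
  then have "norm (op_poly (q - [:d:]) T x) * norm x \<le> ((K + e) / 2 * norm x) * norm x"
    by (intro mult_right_mono order_trans[OF norm_blinfun]) auto
  then have "- ((K + e) / 2 * (norm x)\<^sup>2) \<le> inner (op_poly (q - [:d:]) T x) x"
    using Cauchy_Schwarz_ineq2[of "op_poly (q - [:d:]) T x" x]
    by (simp add: power2_eq_square mult.assoc abs_le_iff)
  also have "op_poly (q - [:d:]) T x = op_poly q T x - d *\<^sub>R x"
    by (simp add: op_poly_diff op_poly_pCons blinfun.bilinear_simps)
  finally show ?thesis
    by (simp add: inner_diff_left d_def power2_norm_eq_inner[symmetric] field_simps)
qed

lemma inner_op_poly_le_cont_fun_calc:
  assumes T: "selfadjoint T" and spec: "real_spectrum T \<subseteq> {a..b}" and f: "continuous_on {a..b} f"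
    and le: "\<And>t. t \<in> real_spectrum T \<Longrightarrow> poly g t \<le> f t" and x: "norm x = 1"
  shows "inner (op_poly g T x) x \<le> inner (cont_fun_calc T f x) x"
proof (rule field_le_epsilon)
  fix e :: real assume e: "e > 0"
  obtain p where "uniform_limit {a..b} (\<lambda>n. poly (p n)) f sequentially"
    using polynomials_converge_uniformly[OF f] .
  then have p: "uniform_limit (real_spectrum T) (\<lambda>n. poly (p n)) f sequentially"
    using spec by (rule uniform_limit_on_subset)
  have "\<forall>\<^sub>F n in sequentially. \<forall>t\<in>real_spectrum T. dist (poly (p n) t) (f t) < e"
    using p e by (rule uniform_limitD)
  then have "\<forall>\<^sub>F n in sequentially. inner (op_poly g T x) x - e \<le> inner (op_poly (p n) T x) x"
  proof eventually_elim
    case (elim n)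
    have "- e * (norm x)\<^sup>2 \<le> inner (op_poly (p n - g) T x) x"
    proof (rule inner_op_poly_ge[OF T spec])
      fix t assume t: "t \<in> real_spectrum T"
      then have "\<bar>poly (p n) t - f t\<bar> < e"
        using elim by (auto simp: dist_real_def)
      then show "- e \<le> poly (p n - g) t"
        using le[OF t] by simp
    qed
    then show ?case
      by (simp add: x op_poly_diff blinfun.diff_left inner_diff_left)
  qed
  moreover have "(\<lambda>n. inner (op_poly (p n) T x) x) \<longlonglongrightarrow> inner (cont_fun_calc T f x) x"
    by (intro tendsto_intros cont_fun_calc_limit[OF T spec f p])
  ultimately have "inner (op_poly g T x) x - e \<le> inner (cont_fun_calc T f x) x"
    by (intro tendsto_lowerbound) auto
  then show "inner (op_poly g T x) x \<le> inner (cont_fun_calc T f x) x + e"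
    by simp
qed

section \<open>Convexity of powers\<close>

lemma powr_ge_tangent:
  fixes a t r :: real
  assumes "a \<ge> 0" "t \<ge> 0" and r: "r \<ge> 1"
  shows "a powr r + r * a powr (r - 1) * (t - a) \<le> t powr r"
proof (cases "a > 0 \<and> t > 0")
  case True
  have "r * a powr (r - 1) * (t - a) \<le> t powr r - a powr r"
  proof (rule convex_on_imp_above_tangent[of "{0<..}" "\<lambda>x. x powr r"])
    show "convex_on {0<..} (\<lambda>x. x powr r)"
      using r by (rule powr_convex)
    have "((\<lambda>x. x powr r) has_real_derivative r * a powr (r - 1)) (at a)"
      using True by (auto intro!: derivative_eq_intros)
    then show "((\<lambda>x. x powr r) has_real_derivative r * a powr (r - 1)) (at a within {0<..})"
      by (rule DERIV_subset) simp
  qed (use True in \<open>auto simp: interior_open\<close>)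
  then show ?thesis
    by simp
next
  case False
  then consider "a = 0" | "a > 0" "t = 0"
    using assms by linarith
  then show ?thesis
  proof cases
    case 2
    then have "a powr (r - 1) * a = a powr r"
      by (simp add: powr_diff)
    then have "a powr r + r * a powr (r - 1) * (t - a) = (1 - r) * a powr r"
      using 2 by (simp add: algebra_simps)
    also have "\<dots> \<le> 0"
      using r by (simp add: mult_le_0_iff)
    finally show ?thesis
      using 2 by simp
  qed simp
qed

lemma powr_midpoint_le:
  fixes s t r :: real
  assumes "s \<ge> 0" "t \<ge> 0" "r \<ge> 1"
  shows "((s + t) / 2) powr r \<le> (s powr r + t powr r) / 2"
proof -
  define a where "a = (s + t) / 2"
  define k where "k = r * a powr (r - 1)"
  have "a powr r + k * (s - a) \<le> s powr r" "a powr r + k * (t - a) \<le> t powr r"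
    unfolding k_def using assms by (auto intro!: powr_ge_tangent simp: a_def)
  moreover have "k * (s - a) + k * (t - a) = 0"
    unfolding distrib_left[symmetric] by (simp add: a_def field_simps)
  ultimately have "2 * a powr r \<le> s powr r + t powr r"
    by linarith
  then show ?thesis
    by (simp add: a_def)
qed

text \<open>Jensen's inequality for the spectral measure of \<open>T\<close> at \<open>x\<close>, due to McCarthy: the tangent to
  \<open>t\<^sup>r\<close> at \<open>\<langle>T x, x\<rangle>\<close> is a polynomial below \<open>t\<^sup>r\<close>, and at \<open>T\<close> it has expectation \<open>\<langle>T x, x\<rangle>\<^sup>r\<close>.\<close>

lemma McCarthy_inequality:
  assumes T: "selfadjoint T" and pos: "\<And>y. 0 \<le> inner (T y) y" and r: "r \<ge> 1" and x: "norm x = 1"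
  shows "inner (T x) x powr r \<le> inner (op_powr T r x) x"
proof -
  define a where "a = inner (T x) x"
  define k where "k = r * a powr (r - 1)"
  \<comment> \<open>the tangent at \<open>a\<close>; for \<open>a = 0\<close> it is the zero polynomial, also when \<open>r = 1\<close>, since \<open>0 powr 0 = 0\<close>\<close>
  define g where "g = [:a powr r - k * a, k:]"
  have spec: "real_spectrum T \<subseteq> {0..norm T}"
    using T pos by (rule real_spectrum_positive)
  have "inner (op_poly g T x) x \<le> inner (cont_fun_calc T (\<lambda>t. t powr r) x) x"
  proof (rule inner_op_poly_le_cont_fun_calc[OF T spec _ _ x])
    show "continuous_on {0..norm T} (\<lambda>t. t powr r)"
      using r by (intro continuous_on_powr' continuous_on_id continuous_on_const) auto
    fix t assume "t \<in> real_spectrum T"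
    then have "a powr r + k * (t - a) \<le> t powr r"
      unfolding k_def using spec pos r by (intro powr_ge_tangent) (auto simp: a_def)
    then show "poly g t \<le> t powr r"
      by (simp add: g_def algebra_simps)
  qed
  also have "inner (op_poly g T x) x = a powr r"
  proof -
    have "inner x x = 1"
      using x by (simp add: power2_norm_eq_inner[symmetric])
    then show ?thesis
      by (simp add: g_def op_poly_apply_pCons blinfun.scaleR_right inner_add_left a_def)
  qed
  finally show ?thesis
    by (simp add: op_powr_def a_def)
qed

section \<open>The numerical radius\<close>

lemma numerical_radius_upper:
  fixes T :: "'a::complex_hilbert \<Rightarrow>\<^sub>L 'a"
  assumes "norm x = 1"
  shows "cmod (cinner (T x) x) \<le> numerical_radius T"
  unfolding numerical_radius_def
proof (rule cSup_upper)
  show "bdd_above (insert 0 {cmod (cinner (T x) x) |x. norm x = 1})"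
  proof (rule bdd_aboveI[of _ "norm T"])
    fix z assume "z \<in> insert 0 {cmod (cinner (T x) x) |x. norm x = 1}"
    then show "z \<le> norm T"
    proof
      assume "z \<in> {cmod (cinner (T x) x) |x. norm x = 1}"
      then obtain x where x: "norm x = 1" "z = cmod (cinner (T x) x)"
        by blast
      then show ?thesis
        using cmod_cinner_le[of "T x" x] norm_blinfun[of T x] by simp
    qed simp
  qed
qed (use assms in blast)

lemma numerical_radius_least:
  fixes T :: "'a::complex_hilbert \<Rightarrow>\<^sub>L 'a"
  assumes "K \<ge> 0" "\<And>x. norm x = 1 \<Longrightarrow> cmod (cinner (T x) x) \<le> K"
  shows "numerical_radius T \<le> K"
  unfolding numerical_radius_def using assms by (intro cSup_least) auto

lemma numerical_radius_nonneg: "0 \<le> numerical_radius T"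
  unfolding numerical_radius_def
proof (rule cSup_upper)
  show "bdd_above (insert 0 {cmod (cinner (T x) x) |x. norm x = 1})"
  proof (rule bdd_aboveI)
    show "z \<le> max 0 (numerical_radius T)" if "z \<in> insert 0 {cmod (cinner (T x) x) |x. norm x = 1}" for z
      using that numerical_radius_upper[of _ T] by (auto simp: max.coboundedI2)
  qed
qed simp

lemma le_norm_square_if_le_on_sphere:
  fixes f :: "'a::real_normed_vector \<Rightarrow> real"
  assumes hom: "\<And>a x. f (a *\<^sub>R x) = a\<^sup>2 * f x" and "\<And>x. norm x = 1 \<Longrightarrow> f x \<le> K"
  shows "f x \<le> K * (norm x)\<^sup>2"
proof (cases "x = 0")
  case True
  then show ?thesis
    using hom[of 0 0] by simp
next
  case False
  then have "f (x /\<^sub>R norm x) \<le> K"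
    by (intro assms(2)) simp
  then show ?thesis
    using False by (simp add: hom field_simps)
qed

lemma cmod_cinner_le_numerical_radius:
  fixes T :: "'a::complex_hilbert \<Rightarrow>\<^sub>L 'a"
  shows "cmod (cinner (T x) x) \<le> numerical_radius T * (norm x)\<^sup>2"
proof (rule le_norm_square_if_le_on_sphere[of "\<lambda>x. cmod (cinner (T x) x)"])
  show "cmod (cinner (T (a *\<^sub>R y)) (a *\<^sub>R y)) = a\<^sup>2 * cmod (cinner (T y) y)" for a y
    unfolding blinfun.scaleR_right
    by (simp add: scaleR_scaleC cinner_scaleC_left cinner_scaleC_right norm_mult power2_eq_square)
qed (rule numerical_radius_upper)

text \<open>With \<open>c\<close> a phase that makes \<open>\<langle>c A x, B x\<rangle>\<close> real and \<open>u = c A x + B x\<close>, polarisation bounds it by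
  \<open>\<parallel>u\<parallel>\<^sup>2 / 4\<close>. Since \<open>u\<close> is in the range of \<open>c A + B\<close>, the norm of \<open>u\<close> is controlled by the adjoint at \<open>u\<close>, and
  expanding \<open>\<parallel>(c A + B)\<^sup>* u\<parallel>\<^sup>2\<close> produces the products \<open>A A\<^sup>*\<close>, \<open>B B\<^sup>*\<close> and \<open>A B\<^sup>*\<close> in the reversed order.\<close>

lemma numerical_radius_adj_comp_le:
  fixes A B :: "'h::complex_hilbert \<Rightarrow>\<^sub>L 'h"
  assumes A: "complex_linear A" and B: "complex_linear B" and m: "m \<ge> 0"
    and bound: "\<And>u. (norm (adj A u))\<^sup>2 + (norm (adj B u))\<^sup>2 \<le> 2 * m * (norm u)\<^sup>2"
  shows "numerical_radius (adj B o\<^sub>L A) \<le> (m + numerical_radius (A o\<^sub>L adj B)) / 2"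
proof (rule numerical_radius_least)
  define W where "W = numerical_radius (A o\<^sub>L adj B)"
  show "0 \<le> (m + numerical_radius (A o\<^sub>L adj B)) / 2"
    using m numerical_radius_nonneg[of "A o\<^sub>L adj B"] by simp
  fix x :: 'h assume x: "norm x = 1"
  obtain c where c: "cmod c = 1" "inner (c *\<^sub>C A x) (B x) = cmod (cinner (A x) (B x))"
    by (rule cinner_rotate)
  define u where "u = c *\<^sub>C A x + B x"
  define v where "v = cnj c *\<^sub>C adj A u + adj B u"
  have "4 * inner (c *\<^sub>C A x) (B x) = (norm u)\<^sup>2 - (norm (c *\<^sub>C A x - B x))\<^sup>2"
    by (simp add: u_def power2_norm_eq_inner inner_simps inner_commute)
  then have polar: "4 * cmod (cinner (A x) (B x)) \<le> (norm u)\<^sup>2"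
    using c(2) zero_le_power2[of "norm (c *\<^sub>C A x - B x)"] by linarith
  have "(norm u)\<^sup>2 = inner (c *\<^sub>C A x) u + inner (B x) u"
    by (simp add: power2_norm_eq_inner u_def inner_add_left)
  also have "\<dots> = inner x v"
    using complex_linear_adj[OF A]
    by (simp add: v_def complex_linear_def inner_scaleC_left inner_adj[OF A] inner_adj[OF B]
        inner_add_right)
  also have "\<dots> \<le> norm v"
    using norm_cauchy_schwarz[of x v] x by simp
  finally have uv: "(norm u)\<^sup>2 \<le> norm v" .
  have "inner (cnj c *\<^sub>C adj A u) (adj B u) \<le> W * (norm u)\<^sup>2"
  proof -
    have "inner (cnj c *\<^sub>C adj A u) (adj B u) \<le> cmod (cinner (cnj c *\<^sub>C adj A u) (adj B u))"
      by (simp add: inner_eq_Re_cinner complex_Re_le_cmod)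
    also have "\<dots> = cmod (cinner (adj A u) (adj B u))"
      using c(1) by (simp add: cinner_scaleC_left norm_mult)
    also have "\<dots> = cmod (cinner ((A o\<^sub>L adj B) u) u)"
      using cinner_commute[of "adj A u" "adj B u"] by (simp add: cinner_adj[OF A])
    also have "\<dots> \<le> W * (norm u)\<^sup>2"
      unfolding W_def by (rule cmod_cinner_le_numerical_radius)
    finally show ?thesis .
  qed
  moreover have "(norm v)\<^sup>2 = (norm (adj A u))\<^sup>2 + (norm (adj B u))\<^sup>2
      + 2 * inner (cnj c *\<^sub>C adj A u) (adj B u)"
    using c(1) dot_norm[of "cnj c *\<^sub>C adj A u" "adj B u"] by (simp add: v_def)
  ultimately have "(norm v)\<^sup>2 \<le> 2 * (m + W) * (norm u)\<^sup>2"
    using bound[of u] by (simp add: algebra_simps)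
  moreover have "((norm u)\<^sup>2)\<^sup>2 \<le> (norm v)\<^sup>2"
    using uv by (intro power_mono) auto
  ultimately have "(norm u)\<^sup>2 * (norm u)\<^sup>2 \<le> 2 * (m + W) * (norm u)\<^sup>2"
    by (simp add: power2_eq_square)
  then have "(norm u)\<^sup>2 \<le> 2 * (m + W)"
  proof (cases "u = 0")
    case True
    then show ?thesis
      using m numerical_radius_nonneg[of "A o\<^sub>L adj B"] by (simp add: W_def)
  next
    case False
    assume "(norm u)\<^sup>2 * (norm u)\<^sup>2 \<le> 2 * (m + W) * (norm u)\<^sup>2"
    then show ?thesis
      by (rule mult_right_le_imp_le) (use False in simp)
  qed
  moreover have "cinner ((adj B o\<^sub>L A) x) x = cinner (A x) (B x)"
    using cinner_commute[of "adj B (A x)" x] cinner_commute[of "A x" "B x"]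
    by (simp add: cinner_adj[OF B])
  ultimately show "cmod (cinner ((adj B o\<^sub>L A) x) x) \<le> (m + numerical_radius (A o\<^sub>L adj B)) / 2"
    using polar by (simp add: W_def)
qed

lemma selfadjoint_comp_adj:
  assumes A: "complex_linear A"
  shows "selfadjoint (A o\<^sub>L adj A)"
  using A complex_linear_adj[OF A]
  by (simp add: selfadjoint_def complex_linear_def inner_adj[OF A])
    (metis A inner_adj inner_commute)

lemma inner_comp_adj:
  assumes A: "complex_linear A"
  shows "inner ((A o\<^sub>L adj A) x) x = (norm (adj A x))\<^sup>2"
  by (simp add: inner_adj[OF A] power2_norm_eq_inner)

text \<open>Convexity of \<open>t\<^sup>r\<close> is used twice: between the two numbers, and inside each operator through
  McCarthy's inequality.\<close>

lemma mean_powr_le_norm_op_powr: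
  assumes P: "selfadjoint P" "\<And>y. 0 \<le> inner (P y) y"
    and Q: "selfadjoint Q" "\<And>y. 0 \<le> inner (Q y) y"
    and r: "r \<ge> 1" and x: "norm x = 1"
  shows "((inner (P x) x + inner (Q x) x) / 2) powr r \<le> norm (op_powr P r + op_powr Q r) / 2"
proof -
  have "((inner (P x) x + inner (Q x) x) / 2) powr r
      \<le> (inner (P x) x powr r + inner (Q x) x powr r) / 2"
    using P(2) Q(2) r by (rule powr_midpoint_le)
  also have "\<dots> \<le> (inner (op_powr P r x) x + inner (op_powr Q r x) x) / 2"
    using McCarthy_inequality[OF P r x] McCarthy_inequality[OF Q r x] by simp
  also have "\<dots> = inner ((op_powr P r + op_powr Q r) x) x / 2"
    by (simp add: blinfun.add_left inner_add_left)
  also have "\<dots> \<le> norm (op_powr P r + op_powr Q r) / 2"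
    using norm_cauchy_schwarz[of "(op_powr P r + op_powr Q r) x" x]
      norm_blinfun[of "op_powr P r + op_powr Q r" x] x by simp
  finally show ?thesis .
qed

theorem theorem2p10:
  fixes A B :: "'h::complex_hilbert \<Rightarrow>\<^sub>L 'h" and r :: real
  assumes "complex_linear A" and "complex_linear B" and "r \<ge> 1"
  shows "numerical_radius (adj B o\<^sub>L A) powr r
    \<le> 1 / 4 * norm (op_powr (A o\<^sub>L adj A) r + op_powr (B o\<^sub>L adj B) r)
      + 1 / 2 * numerical_radius (A o\<^sub>L adj B) powr r"
proof -
  note A = assms(1) and B = assms(2) and r = assms(3)
  define N where "N = norm (op_powr (A o\<^sub>L adj A) r + op_powr (B o\<^sub>L adj B) r)"
  \<comment> \<open>\<open>2 m\<close> bounds \<open>\<langle>(A A\<^sup>* + B B\<^sup>*) u, u\<rangle>\<close> on unit vectors, while \<open>m\<^sup>r = N / 2\<close>\<close>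
  define m where "m = (N / 2) powr (1 / r)"
  define W where "W = numerical_radius (A o\<^sub>L adj B)"
  have m_powr: "m powr r = N / 2"
    using r by (simp add: m_def powr_powr N_def)
  have "(norm (adj A u))\<^sup>2 + (norm (adj B u))\<^sup>2 \<le> 2 * m * (norm u)\<^sup>2" for u
  proof (rule le_norm_square_if_le_on_sphere[of "\<lambda>u. (norm (adj A u))\<^sup>2 + (norm (adj B u))\<^sup>2"])
    show "(norm (adj A (a *\<^sub>R y)))\<^sup>2 + (norm (adj B (a *\<^sub>R y)))\<^sup>2
        = a\<^sup>2 * ((norm (adj A y))\<^sup>2 + (norm (adj B y))\<^sup>2)" for a y
      by (simp add: blinfun.scaleR_right power_mult_distrib distrib_left)
    fix y :: 'h assume y: "norm y = 1"
    let ?s = "((norm (adj A y))\<^sup>2 + (norm (adj B y))\<^sup>2) / 2"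
    have "?s powr r \<le> N / 2"
      using mean_powr_le_norm_op_powr[OF selfadjoint_comp_adj[OF A] _ selfadjoint_comp_adj[OF B] _ r y]
      by (simp only: inner_comp_adj[OF A] inner_comp_adj[OF B] N_def zero_le_power2)
    then have "(?s powr r) powr (1 / r) \<le> m"
      unfolding m_def using r by (intro powr_mono2) auto
    then show "(norm (adj A y))\<^sup>2 + (norm (adj B y))\<^sup>2 \<le> 2 * m"
      using r by (simp add: powr_powr)
  qed
  then have "numerical_radius (adj B o\<^sub>L A) \<le> (m + W) / 2"
    unfolding W_def by (intro numerical_radius_adj_comp_le A B) (auto simp: m_def)
  then have "numerical_radius (adj B o\<^sub>L A) powr r \<le> ((m + W) / 2) powr r"
    using r numerical_radius_nonneg by (intro powr_mono2) auto
  also have "\<dots> \<le> (m powr r + W powr r) / 2"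
    using r by (intro powr_midpoint_le) (auto simp: m_def W_def numerical_radius_nonneg)
  also have "\<dots> = 1 / 4 * N + 1 / 2 * W powr r"
    by (simp add: m_powr)
  finally show ?thesis
    by (simp add: N_def W_def)
qed

end
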